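(* Let $\hat P_{N,\rho,A}$ be the program defined in the context and $\mathcal K:=\{(j,k,i): i\in\mathcal N,\ k\in\mathcal T,\ j\in\mathcal M_i\}$. Write $c=(c_k)_{k\in\mathcal T}$ and $\xi=(\xi_i)_{i\in\mathcal N}$. (i) Suppose that for each $k\in\mathcal T$ the candidate reachable sets are $p$-normed balls $\mathcal R_k(c_k,r_k)=\{x\in\mathbb R^{n_x}:\|x-c_k\|_p\le r_k\}$ with $c_k\in\mathbb R^{n_x}$, $r_k\in\mathbb R_{\ge0}$, and take the size proxy $S(\mathcal R_k)=r_k$; write $r=(r_k)_{k\in\mathcal T}$. Then $\hat P_{N,\rho,A}$ can be written as $$\min_{(c,r,\xi)\in\mathbb R^{n_x(T+1)}\times\mathbb R^{T+1}_{\ge0}\times\mathbb R^N_{\ge0}}\ \sum_{k\in\mathcal T}\Big(r_k+\rho\sum_{i\in\mathcal N}\xi_i\Big)\quad\text{s.t.}\quad\|x_k^{(i,j)}-c_k\|_p\le r_k+\xi_i,\ \ \forall(j,k,i)\in\mathcal K.$$ (ii) Suppose that for each $k\in\mathcal T$ the candidate reachable sets are ellipsoids $\mathcal R_k(c_k,s_k)=\{x:\|H_k(x-c_k)\|_2\le s_k\}$, where $H_k\in\mathbb S^{n_x}_{\succ0}$ is fixed, and take the size proxy $S(\mathcal R_k)=s_k$; write $s=(s_k)_{k\in\mathcal T}$. Then $\hat P_{N,\rho,A}$ can be written as $$\min_{(c,s,\xi)\in\mathbb R^{n_x(T+1)}\times\mathbb R^{T+1}_{\ge0}\times\mathbb R^N_{\ge0}}\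 \sum_{k\in\mathcal T}\Big(s_k+\rho\sum_{i\in\mathcal N}\xi_i\Big)\quad\text{s.t.}\quad\|H_k(x_k^{(i,j)}-c_k)\|_2\le s_k+\xi_i,\ \ \forall(j,k,i)\in\mathcal K.$$ (iii) Suppose that for each $k\in\mathcal T$ the candidate reachable sets are zonotopes $\mathcal R_k(c_k,a_k)=\{x\in\mathbb R^{n_x}:\exists\,\zeta\in\mathbb R^m,\ x=c_k+G_k\zeta,\ |\zeta|\le a_k\}$ (inequality and absolute value componentwise), with center $c_k\in\mathbb R^{n_x}$, half-widths $a_k\in\mathbb R^m_+$ and fixed generator matrix $G_k\in\mathbb R^{n_x\times m}$, and take the size proxy $S(\mathcal R_k)=\mathbf 1_m^\top a_k$; write $a=(a_k)_{k\in\mathcal T}$ and $\zeta=(\zeta_{i,k,j})_{(j,k,i)\in\mathcal K}$ with $\zeta_{i,k,j}\in\mathbb R^m$. Then $\hat P_{N,\rho,A}$ can be written as $$\min_{c,\,a,\,\xi,\,\zeta}\ \sum_{k\in\mathcal T}\Big(\mathbf 1_m^\top a_k+\rho\sum_{i\in\mathcal N}\xi_i\Big)$$ $$\text{s.t.}\quad c_k+G_k\zeta_{i,k,j}=x_k^{(i,j)},\qquad -(a_k+\xi_i\mathbf 1_m)\le\zeta_{i,k,j}\le a_k+\xi_i\mathbf 1_m,\qquad\forall(j,k,i)\in\mathcal K,$$ where the minimization is over $c\in\mathbb R^{n_x(T+1)}$, $a\in\mathbb R^{m(T+1)}_{\ge0}$, $\xi\in\mathbb R^N_{\ge0}$ and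 $\zeta\in(\mathbb R^m)^{\mathcal K}$.
   Context: $\mathcal T=\{0,\dots,T\}$, $\mathcal N=\{1,\dots,N\}$. Sampled trajectories are $x^{(i)}=(x_k^{(i)})_{k\in\mathcal T}$, $x_k^{(i)}\in\mathbb R^{n_x}$. For each $i\in\mathcal N$, $x^{(i,j)}=(x_k^{(i,j)})_{k\in\mathcal T}$, $j\in\mathcal M_i$ ($\mathcal M_i$ finite), are given points in trajectory space: the vertices of a polytopic approximation of the set of adversarial perturbations of $x^{(i)}$. $\rho>0$ is a penalty parameter. Candidate reachable sets are $\mathcal R_k(\theta_k)=\{z\in\mathbb R^{n_x}: g_k(z,\theta_k)\le0\}$, with $\theta=(\theta_k)_{k\in\mathcal T}\in\Theta$ and $g(x,\theta)=\max_{k\in\mathcal T}g_k(x_k,\theta_k)$; $S(\mathcal R_k(\theta_k))$ is a size proxy. The program $\hat P_{N,\rho,A}$ is $$\min_{\theta\in\Theta,\ \xi\in\mathbb R^N_{\ge0}}\ \sum_{k\in\mathcal T}\Big[S(\mathcal R_k(\theta_k))+\rho\sum_{i\in\mathcal N}\xi_i\Big]\quad\text{s.t.}\quad g(x^{(i,j)},\theta)\le\xi_i,\ \ \forall j\in\mathcal M_i,\ \forall i\in\mathcal N.$$ The constraint functions are: for $p$-normed balls, $g_k(z,(c_k,r_k))=\|z-c_k\|_p-r_k$; for the ellipsoids with fixed shape $H_k$, $g_k(z,(c_k,s_k))=\|H_k(z-c_k)\|_2-s_k$ with $s_k\ge0$; for zonotopes, $g_k(z,(c_k,a_k))=\inf\{\max_{l=1,\dots,m}(|\zeta_l|-a_{k,l}):\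 \zeta\in\mathbb R^m,\ z=c_k+G_k\zeta\}$ (equal to $+\infty$ if no such $\zeta$ exists), i.e. the relaxation by $\xi_i$ enlarges every half-width by $\xi_i$. $\mathbf 1_m$ is the all-ones vector in $\mathbb R^m$ and $\mathbb S^{n_x}_{\succ0}$ is the set of symmetric positive definite $n_x\times n_x$ matrices. "Can be written as" means that the two programs are equivalent (in (iii), after introducing the auxiliary variables $\zeta$). *)

theory Defs
  imports "HOL-Analysis.Analysis"
begin

section \<open>Minimization programs and their equivalence\<close>

datatype 'v program = Program (feasible: "'v set") (objective: "'v \<Rightarrow> real")

definition optimal_value :: "'v program \<Rightarrow> ereal" where
  "optimal_value P = (INF v\<in>feasible P. ereal (objective P v))"

definition minimizers :: "'v program \<Rightarrow> 'v set" where
  "minimizers P = {v \<in> feasible P. \<forall>w\<in>feasible P. objective P v \<le> objective P w}"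

text \<open>\<^term>\<open>\<pi>\<close> may forget auxiliary variables of \<^term>\<open>Q\<close>: the feasible points of
  \<^term>\<open>P\<close> are exactly those that extend to a feasible point of \<^term>\<open>Q\<close>, and every
  extension has the same cost.\<close>

definition equivalent_via :: "('w \<Rightarrow> 'v) \<Rightarrow> 'v program \<Rightarrow> 'w program \<Rightarrow> bool" where
  "equivalent_via \<pi> P Q \<longleftrightarrow>
     \<pi> ` feasible Q = feasible P \<and>
     (\<forall>w\<in>feasible Q. objective P (\<pi> w) = objective Q w)"

text \<open>Equivalence without auxiliary variables: \<^term>\<open>\<pi>\<close> merely renames the decision variables.\<close>

definition equivalent_renaming :: "('w \<Rightarrow> 'v) \<Rightarrow> 'v program \<Rightarrow> 'w program \<Rightarrow> bool" where
  "equivalent_renaming \<pi> P Q \<longleftrightarrow> equivalent_via \<pi> P Q \<and> inj_on \<pi> (feasible Q)"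

lemma equivalent_via_optimal_value:
  assumes "equivalent_via \<pi> P Q"
  shows "optimal_value P = optimal_value Q"
proof -
  have F: "feasible P = \<pi> ` feasible Q" using assms by (simp add: equivalent_via_def)
  have O: "objective P (\<pi> w) = objective Q w" if "w \<in> feasible Q" for w
    using assms that by (simp add: equivalent_via_def)
  show ?thesis
    unfolding optimal_value_def F image_image by (intro INF_cong) (auto simp: O)
qed

lemma equivalent_via_minimizers:
  assumes "equivalent_via \<pi> P Q"
  shows "minimizers P = \<pi> ` minimizers Q"
proof -
  have F: "feasible P = \<pi> ` feasible Q" using assms by (simp add: equivalent_via_def)
  have O: "objective P (\<pi> w) = objective Q w" if "w \<in> feasible Q" for w
    using assms that by (simp add: equivalent_via_def)
  show ?thesis
    unfolding minimizers_def F using O by (auto simp: image_iff)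
qed


section \<open>The sampled adversarial program\<close>

text \<open>Families \<open>(y_k)\<close> over \<open>{0..T}\<close> and \<open>(\<xi>_i)\<close> over \<open>{1..N}\<close> are extensional functions, so
  that they correspond one-to-one to finite tuples.  Constraint functions take extended real
  values because the one for zonotopes can be infinite.\<close>

definition reach_set :: "(nat \<Rightarrow> 'x \<Rightarrow> 'p \<Rightarrow> ereal) \<Rightarrow> nat \<Rightarrow> 'p \<Rightarrow> 'x set" where
  "reach_set g k \<theta>\<^sub>k = {z. g k z \<theta>\<^sub>k \<le> 0}"

definition trajectory_constraint ::
    "nat \<Rightarrow> (nat \<Rightarrow> 'x \<Rightarrow> 'p \<Rightarrow> ereal) \<Rightarrow> (nat \<Rightarrow> 'x) \<Rightarrow> (nat \<Rightarrow> 'p) \<Rightarrow> ereal" where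
  "trajectory_constraint T g x \<theta> = Max ((\<lambda>k. g k (x k) (\<theta> k)) ` {0..T})"

text \<open>\<open>x i j k\<close> is the state at time \<open>k\<close> of the \<open>j\<close>-th vertex for sample \<open>i\<close>.  The size proxy
  \<open>S k\<close> acts on the parameter of the candidate set: for zonotopes the same set can have several
  parameters, of different size.\<close>

definition adversarial_program ::
    "nat \<Rightarrow> nat \<Rightarrow> real \<Rightarrow> (nat \<Rightarrow> 'j set) \<Rightarrow> (nat \<Rightarrow> 'j \<Rightarrow> nat \<Rightarrow> 'x) \<Rightarrow>
     (nat \<Rightarrow> 'p) set \<Rightarrow> (nat \<Rightarrow> 'p \<Rightarrow> real) \<Rightarrow> (nat \<Rightarrow> 'x \<Rightarrow> 'p \<Rightarrow> ereal) \<Rightarrow>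
     ((nat \<Rightarrow> 'p) \<times> (nat \<Rightarrow> real)) program" where
  "adversarial_program T N \<rho> M x \<Theta> S g = Program
     {(\<theta>, \<xi>). \<theta> \<in> \<Theta> \<and> \<xi> \<in> {1..N} \<rightarrow>\<^sub>E {0..} \<and>
        (\<forall>i\<in>{1..N}. \<forall>j\<in>M i. trajectory_constraint T g (x i j) \<theta> \<le> ereal (\<xi> i))}
     (\<lambda>(\<theta>, \<xi>). \<Sum>k=0..T. (S k (\<theta> k) + \<rho> * (\<Sum>i=1..N. \<xi> i)))"

definition index_set :: "nat \<Rightarrow> nat \<Rightarrow> (nat \<Rightarrow> 'j set) \<Rightarrow> ('j \<times> nat \<times> nat) set" where
  "index_set T N M = {(j, k, i). i \<in> {1..N} \<and> k \<in> {0..T} \<and> j \<in> M i}"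


section \<open>Balls, ellipsoids and zonotopes\<close>

definition pnorm :: "ereal \<Rightarrow> real ^ 'n \<Rightarrow> real" where
  "pnorm p z = (if p = \<infinity> then infnorm z
     else (\<Sum>l\<in>UNIV. \<bar>z $ l\<bar> powr real_of_ereal p) powr (1 / real_of_ereal p))"

definition ball_constraint ::
    "ereal \<Rightarrow> nat \<Rightarrow> real ^ 'n \<Rightarrow> (real ^ 'n) \<times> real \<Rightarrow> ereal" where
  "ball_constraint p k z = (\<lambda>(c, r). ereal (pnorm p (z - c) - r))"

definition positive_definite_matrix :: "real ^ 'n ^ 'n \<Rightarrow> bool" where
  "positive_definite_matrix A \<longleftrightarrow> transpose A = A \<and> (\<forall>v. v \<noteq> 0 \<longrightarrow> 0 < v \<bullet> (A *v v))"

definition ellipsoid_constraint ::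
    "(nat \<Rightarrow> real ^ 'n ^ 'n) \<Rightarrow> nat \<Rightarrow> real ^ 'n \<Rightarrow> (real ^ 'n) \<times> real \<Rightarrow> ereal" where
  "ellipsoid_constraint H k z = (\<lambda>(c, s). ereal (norm (H k *v (z - c)) - s))"

definition zonotope_constraint ::
    "(nat \<Rightarrow> real ^ 'm ^ 'n) \<Rightarrow> nat \<Rightarrow> real ^ 'n \<Rightarrow> (real ^ 'n) \<times> (real ^ 'm) \<Rightarrow> ereal" where
  "zonotope_constraint G k z = (\<lambda>(c, a).
     INF \<zeta>\<in>{\<zeta>. z = c + G k *v \<zeta>}. ereal (Max (range (\<lambda>l. \<bar>\<zeta> $ l\<bar> - a $ l))))"

definition center_radius_params :: "nat \<Rightarrow> (nat \<Rightarrow> (real ^ 'n) \<times> real) set" where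
  "center_radius_params T = {0..T} \<rightarrow>\<^sub>E UNIV \<times> {0..}"

definition zonotope_params :: "nat \<Rightarrow> (nat \<Rightarrow> (real ^ 'n) \<times> (real ^ 'm)) set" where
  "zonotope_params T = {0..T} \<rightarrow>\<^sub>E UNIV \<times> {a. \<forall>l. 0 \<le> a $ l}"


section \<open>The explicit programs\<close>

definition ball_program ::
    "nat \<Rightarrow> nat \<Rightarrow> real \<Rightarrow> (nat \<Rightarrow> 'j set) \<Rightarrow> (nat \<Rightarrow> 'j \<Rightarrow> nat \<Rightarrow> real ^ 'n) \<Rightarrow> ereal \<Rightarrow>
     ((nat \<Rightarrow> real ^ 'n) \<times> (nat \<Rightarrow> real) \<times> (nat \<Rightarrow> real)) program" where
  "ball_program T N \<rho> M x p = Program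
     {(c, r, \<xi>). c \<in> {0..T} \<rightarrow>\<^sub>E UNIV \<and> r \<in> {0..T} \<rightarrow>\<^sub>E {0..} \<and> \<xi> \<in> {1..N} \<rightarrow>\<^sub>E {0..} \<and>
        (\<forall>(j, k, i)\<in>index_set T N M. pnorm p (x i j k - c k) \<le> r k + \<xi> i)}
     (\<lambda>(c, r, \<xi>). \<Sum>k=0..T. (r k + \<rho> * (\<Sum>i=1..N. \<xi> i)))"

definition ellipsoid_program ::
    "nat \<Rightarrow> nat \<Rightarrow> real \<Rightarrow> (nat \<Rightarrow> 'j set) \<Rightarrow> (nat \<Rightarrow> 'j \<Rightarrow> nat \<Rightarrow> real ^ 'n) \<Rightarrow>
     (nat \<Rightarrow> real ^ 'n ^ 'n) \<Rightarrow>
     ((nat \<Rightarrow> real ^ 'n) \<times> (nat \<Rightarrow> real) \<times> (nat \<Rightarrow> real)) program" where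
  "ellipsoid_program T N \<rho> M x H = Program
     {(c, s, \<xi>). c \<in> {0..T} \<rightarrow>\<^sub>E UNIV \<and> s \<in> {0..T} \<rightarrow>\<^sub>E {0..} \<and> \<xi> \<in> {1..N} \<rightarrow>\<^sub>E {0..} \<and>
        (\<forall>(j, k, i)\<in>index_set T N M. norm (H k *v (x i j k - c k)) \<le> s k + \<xi> i)}
     (\<lambda>(c, s, \<xi>). \<Sum>k=0..T. (s k + \<rho> * (\<Sum>i=1..N. \<xi> i)))"

text \<open>Here \<open>\<le>\<close> on vectors is componentwise and \<open>1\<close> is the all-ones vector.\<close>

definition zonotope_program ::
    "nat \<Rightarrow> nat \<Rightarrow> real \<Rightarrow> (nat \<Rightarrow> 'j set) \<Rightarrow> (nat \<Rightarrow> 'j \<Rightarrow> nat \<Rightarrow> real ^ 'n) \<Rightarrow>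
     (nat \<Rightarrow> real ^ 'm ^ 'n) \<Rightarrow>
     ((nat \<Rightarrow> real ^ 'n) \<times> (nat \<Rightarrow> real ^ 'm) \<times> (nat \<Rightarrow> real) \<times>
      ('j \<times> nat \<times> nat \<Rightarrow> real ^ 'm)) program" where
  "zonotope_program T N \<rho> M x G = Program
     {(c, a, \<xi>, \<zeta>). c \<in> {0..T} \<rightarrow>\<^sub>E UNIV \<and> a \<in> {0..T} \<rightarrow>\<^sub>E {a. \<forall>l. 0 \<le> a $ l} \<and>
        \<xi> \<in> {1..N} \<rightarrow>\<^sub>E {0..} \<and> \<zeta> \<in> index_set T N M \<rightarrow>\<^sub>E UNIV \<and>
        (\<forall>(j, k, i)\<in>index_set T N M.
           c k + G k *v \<zeta> (j, k, i) = x i j k \<and>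
           - (a k + \<xi> i *\<^sub>R 1) \<le> \<zeta> (j, k, i) \<and> \<zeta> (j, k, i) \<le> a k + \<xi> i *\<^sub>R 1)}
     (\<lambda>(c, a, \<xi>, \<zeta>). \<Sum>k=0..T. (1 \<bullet> a k + \<rho> * (\<Sum>i=1..N. \<xi> i)))"

text \<open>Regroup the two parameter families into \<open>\<theta> = (\<theta>_k)\<close>, forgetting auxiliary
  variables in the second map.\<close>

definition pair_params ::
    "nat \<Rightarrow> (nat \<Rightarrow> 'a) \<times> (nat \<Rightarrow> 'b) \<times> 'c \<Rightarrow> (nat \<Rightarrow> 'a \<times> 'b) \<times> 'c" where
  "pair_params T = (\<lambda>(c, r, \<xi>). (\<lambda>k\<in>{0..T}. (c k, r k), \<xi>))"

definition pair_params_forget ::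
    "nat \<Rightarrow> (nat \<Rightarrow> 'a) \<times> (nat \<Rightarrow> 'b) \<times> 'c \<times> 'd \<Rightarrow> (nat \<Rightarrow> 'a \<times> 'b) \<times> 'c" where
  "pair_params_forget T = (\<lambda>(c, a, \<xi>, \<zeta>). pair_params T (c, a, \<xi>))"

end

theory Submission
  imports Defs
begin

text \<open>
  The slack program asks that, for each vertex trajectory, the largest of the values
  \<open>g_k(x_k, \<theta>_k)\<close> be at most \<open>\<xi>_i\<close>.  A maximum over finitely many times is at most \<open>\<xi>_i\<close> exactly when
  each value is, and splitting every \<open>\<theta>_k\<close> into its two components loses nothing.  So for any constraint
  functions whatsoever the program is a mere renaming of one with a separate inequality for each
  \<open>(j, k, i)\<close> (\<open>split_program\<close>, \<open>equivalent_renaming_split_program\<close>).  The three cases then differ only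
  in what the single inequality \<open>g_k(z, \<theta>_k) \<le> t\<close> means.

  For balls and ellipsoids this is moving the radius to the other side, and the split program
  is literally the explicit one.

  For zonotopes the constraint function is an infimum over the representations \<open>\<zeta>\<close> of the point, and an
  infimum that is at most \<open>t\<close> need not in general be attained at a value at most \<open>t\<close>.  Here it is
  (\<open>zonotope_constraint_le_iff\<close>): the representations whose value is at most \<open>t + 1/(n+1)\<close> form
  a closed affine set cut with a box, so they are decreasing nonempty compact sets, and a common
  point of all of them has value at most \<open>t\<close>.  Hence a feasible point of the split program can be extended
  by one such \<open>\<zeta>\<close> for each index, and conversely any such \<open>\<zeta>\<close> witnesses feasibility; the cost ignores
  \<open>\<zeta>\<close>.  Taking \<open>t = 0\<close> in the same equivalences describes the candidate sets themselves.
\<close>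

section \<open>One inequality per vertex and time\<close>

lemma trajectory_constraint_le_iff:
  "trajectory_constraint T g x \<theta> \<le> u \<longleftrightarrow> (\<forall>k\<in>{0..T}. g k (x k) (\<theta> k) \<le> u)"
  unfolding trajectory_constraint_def by (subst Max_le_iff) auto

text \<open>The common form of the explicit programs, for an arbitrary constraint function and arbitrary
  ranges \<open>A\<close>, \<open>B\<close> of the two parameter components.\<close>

definition split_program ::
    "nat \<Rightarrow> nat \<Rightarrow> real \<Rightarrow> (nat \<Rightarrow> 'j set) \<Rightarrow> (nat \<Rightarrow> 'j \<Rightarrow> nat \<Rightarrow> 'x) \<Rightarrow> 'a set \<Rightarrow> 'b set \<Rightarrow>
     (nat \<Rightarrow> 'a \<times> 'b \<Rightarrow> real) \<Rightarrow> (nat \<Rightarrow> 'x \<Rightarrow> 'a \<times> 'b \<Rightarrow> ereal) \<Rightarrow>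
     ((nat \<Rightarrow> 'a) \<times> (nat \<Rightarrow> 'b) \<times> (nat \<Rightarrow> real)) program" where
  "split_program T N \<rho> M x A B S g = Program
     {(c, r, \<xi>). c \<in> {0..T} \<rightarrow>\<^sub>E A \<and> r \<in> {0..T} \<rightarrow>\<^sub>E B \<and> \<xi> \<in> {1..N} \<rightarrow>\<^sub>E {0..} \<and>
        (\<forall>(j, k, i)\<in>index_set T N M. g k (x i j k) (c k, r k) \<le> ereal (\<xi> i))}
     (\<lambda>(c, r, \<xi>). \<Sum>k=0..T. (S k (c k, r k) + \<rho> * (\<Sum>i=1..N. \<xi> i)))"

lemma inj_on_pair_params:
  "inj_on (pair_params T) {(c, r, \<xi>). c \<in> {0..T} \<rightarrow>\<^sub>E A \<and> r \<in> {0..T} \<rightarrow>\<^sub>E B}"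
proof (rule inj_onI, clarsimp simp: pair_params_def)
  fix c r c' r'
  assume dom: "c \<in> {0..T} \<rightarrow>\<^sub>E A" "r \<in> {0..T} \<rightarrow>\<^sub>E B" "c' \<in> {0..T} \<rightarrow>\<^sub>E A" "r' \<in> {0..T} \<rightarrow>\<^sub>E B"
    and eq: "(\<lambda>k\<in>{0..T}. (c k, r k)) = (\<lambda>k\<in>{0..T}. (c' k, r' k))"
  have "c k = c' k \<and> r k = r' k" if "k \<in> {0..T}" for k
    using fun_cong[OF eq, of k] that by simp
  then show "c = c' \<and> r = r'"
    using PiE_ext[OF dom(1,3)] PiE_ext[OF dom(2,4)] by simp
qed

lemma pair_params_feasible_iff:
  assumes "c \<in> extensional {0..T}" "r \<in> extensional {0..T}"
  shows "pair_params T (c, r, \<xi>) \<in>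
      feasible (adversarial_program T N \<rho> M x ({0..T} \<rightarrow>\<^sub>E A \<times> B) S g) \<longleftrightarrow>
    (c, r, \<xi>) \<in> feasible (split_program T N \<rho> M x A B S g)"
proof -
  have "(\<lambda>k\<in>{0..T}. (c k, r k)) \<in> {0..T} \<rightarrow>\<^sub>E A \<times> B \<longleftrightarrow>
      c \<in> {0..T} \<rightarrow>\<^sub>E A \<and> r \<in> {0..T} \<rightarrow>\<^sub>E B"
    using assms by (auto simp: PiE_iff)
  moreover have "(\<forall>i\<in>{1..N}. \<forall>j\<in>M i.
        trajectory_constraint T g (x i j) (\<lambda>k\<in>{0..T}. (c k, r k)) \<le> ereal (\<xi> i)) \<longleftrightarrow>
      (\<forall>(j, k, i)\<in>index_set T N M. g k (x i j k) (c k, r k) \<le> ereal (\<xi> i))"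
    by (fastforce simp: trajectory_constraint_le_iff index_set_def)
  ultimately show ?thesis
    by (simp add: adversarial_program_def split_program_def pair_params_def)
qed

lemma pair_params_components:
  assumes "\<theta> \<in> extensional {0..T}"
  shows "pair_params T (\<lambda>k\<in>{0..T}. fst (\<theta> k), \<lambda>k\<in>{0..T}. snd (\<theta> k), \<xi>) = (\<theta>, \<xi>)"
  using assms by (auto simp: pair_params_def extensional_def)

lemma equivalent_renaming_split_program:
  "equivalent_renaming (pair_params T)
     (adversarial_program T N \<rho> M x ({0..T} \<rightarrow>\<^sub>E A \<times> B) S g)
     (split_program T N \<rho> M x A B S g)"
proof -
  let ?P = "adversarial_program T N \<rho> M x ({0..T} \<rightarrow>\<^sub>E A \<times> B) S g"
  let ?Q = "split_program T N \<rho> M x A B S g"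
  have dom: "feasible ?Q \<subseteq> {(c, r, \<xi>). c \<in> {0..T} \<rightarrow>\<^sub>E A \<and> r \<in> {0..T} \<rightarrow>\<^sub>E B}"
    by (auto simp: split_program_def)
  have into: "pair_params T ` feasible ?Q \<subseteq> feasible ?P"
  proof
    fix v assume "v \<in> pair_params T ` feasible ?Q"
    then obtain c r \<xi> where v: "v = pair_params T (c, r, \<xi>)" and Q: "(c, r, \<xi>) \<in> feasible ?Q"
      by auto
    then show "v \<in> feasible ?P"
      using dom by (subst v, subst pair_params_feasible_iff) (auto simp: PiE_iff)
  qed
  have onto: "feasible ?P \<subseteq> pair_params T ` feasible ?Q"
  proof
    fix v assume P: "v \<in> feasible ?P"
    then obtain \<theta> \<xi> where v: "v = (\<theta>, \<xi>)" and \<theta>: "\<theta> \<in> extensional {0..T}"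
      by (auto simp: adversarial_program_def PiE_iff)
    let ?w = "(\<lambda>k\<in>{0..T}. fst (\<theta> k), \<lambda>k\<in>{0..T}. snd (\<theta> k), \<xi>)"
    have v': "v = pair_params T ?w"
      using v \<theta> by (simp add: pair_params_components)
    with P have "?w \<in> feasible ?Q"
      by (simp only: pair_params_feasible_iff restrict_extensional)
    with v' show "v \<in> pair_params T ` feasible ?Q"
      by blast
  qed
  have "objective ?P (pair_params T w) = objective ?Q w" for w
    by (cases w) (auto simp: adversarial_program_def split_program_def pair_params_def
        intro!: sum.cong)
  with into onto show ?thesis
    unfolding equivalent_renaming_def equivalent_via_def
    using inj_on_subset[OF inj_on_pair_params dom] by blast
qed


section \<open>Balls and ellipsoids\<close>

lemma ball_constraint_le_iff:
  "ball_constraint p k z (c, r) \<le> ereal t \<longleftrightarrow> pnorm p (z - c) \<le> r + t"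
  by (auto simp: ball_constraint_def)

lemma ellipsoid_constraint_le_iff:
  "ellipsoid_constraint H k z (c, s) \<le> ereal t \<longleftrightarrow> norm (H k *v (z - c)) \<le> s + t"
  by (auto simp: ellipsoid_constraint_def)

lemma ball_program_eq_split_program:
  "ball_program T N \<rho> M x p =
     split_program T N \<rho> M x UNIV {0..} (\<lambda>k (c, r). r) (ball_constraint p)"
  by (simp add: ball_program_def split_program_def ball_constraint_le_iff)

lemma ellipsoid_program_eq_split_program:
  "ellipsoid_program T N \<rho> M x H =
     split_program T N \<rho> M x UNIV {0..} (\<lambda>k (c, s). s) (ellipsoid_constraint H)"
  by (simp add: ellipsoid_program_def split_program_def ellipsoid_constraint_le_iff)


section \<open>Zonotopes\<close>

lemma compact_affine_fibre_box:
  fixes G :: "real ^ 'm ^ 'n" and b :: "real ^ 'm"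
  shows "compact {\<zeta>. z = c + G *v \<zeta> \<and> (\<forall>l. \<bar>\<zeta> $ l\<bar> \<le> b $ l)}"
proof -
  have "closed {\<zeta>. z = c + G *v \<zeta>}"
    by (intro closed_Collect_eq continuous_intros
        linear_continuous_on matrix_vector_mul_bounded_linear)
  moreover have "{\<zeta>. z = c + G *v \<zeta> \<and> (\<forall>l. \<bar>\<zeta> $ l\<bar> \<le> b $ l)} = cbox (- b) b \<inter> {\<zeta>. z = c + G *v \<zeta>}"
    by (auto simp: mem_box_cart abs_le_iff minus_le_iff)
  ultimately show ?thesis
    by (simp add: compact_Int_closed)
qed

text \<open>The infimum is attained, by compactness of the relaxed sets of representations; in particular
  the value \<open>\<infinity>\<close> of an empty infimum is excluded by the finite bound.\<close>

lemma zonotope_constraint_le_iff: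
  fixes G :: "nat \<Rightarrow> real ^ 'm ^ 'n"
  shows "zonotope_constraint G k z (c, a) \<le> ereal t \<longleftrightarrow>
    (\<exists>\<zeta>. z = c + G k *v \<zeta> \<and> (\<forall>l. \<bar>\<zeta> $ l\<bar> \<le> a $ l + t))"
proof
  assume le: "zonotope_constraint G k z (c, a) \<le> ereal t"
  \<comment> \<open>The slack turns the bound on the infimum into a strict one, which some representation meets.\<close>
  define F where "F n = {\<zeta>. z = c + G k *v \<zeta> \<and>
    (\<forall>l. \<bar>\<zeta> $ l\<bar> \<le> (\<chi> l. a $ l + t + 1 / real (Suc n)) $ l)}" for n
  have "\<Inter> (range F) \<noteq> {}"
  proof (rule compact_nest)
    show "compact (F n)" for n
      unfolding F_def by (rule compact_affine_fibre_box)
    show "F n \<noteq> {}" for n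
    proof -
      have "zonotope_constraint G k z (c, a) < ereal (t + 1 / real (Suc n))"
        by (rule le_less_trans[OF le]) simp
      then obtain \<zeta> where "z = c + G k *v \<zeta>"
        and "Max (range (\<lambda>l. \<bar>\<zeta> $ l\<bar> - a $ l)) < t + 1 / real (Suc n)"
        by (auto simp: zonotope_constraint_def INF_less_iff)
      then have "\<zeta> \<in> F n"
        by (auto simp: F_def algebra_simps intro: less_imp_le)
      then show ?thesis by blast
    qed
    show "F n \<subseteq> F m" if "m \<le> n" for m n
    proof -
      have "1 / real (Suc n) \<le> 1 / real (Suc m)"
        using that by (simp add: frac_le)
      then show ?thesis
        unfolding F_def by (auto intro: order_trans simp del: of_nat_Suc)
    qed
  qed
  then obtain \<zeta> where \<zeta>: "\<zeta> \<in> F n" for n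
    by blast
  have "\<bar>\<zeta> $ l\<bar> \<le> a $ l + t" for l
  proof (rule LIMSEQ_le_const)
    show "(\<lambda>n. a $ l + t + 1 / real (Suc n)) \<longlonglongrightarrow> a $ l + t"
      using tendsto_add[OF tendsto_const LIMSEQ_inverse_real_of_nat, of "a $ l + t"]
      by (simp add: inverse_eq_divide)
    show "\<exists>n0. \<forall>n\<ge>n0. \<bar>\<zeta> $ l\<bar> \<le> a $ l + t + 1 / real (Suc n)"
      using \<zeta> by (auto simp: F_def)
  qed
  moreover have "z = c + G k *v \<zeta>"
    using \<zeta>[of 0] by (simp add: F_def)
  ultimately show "\<exists>\<zeta>. z = c + G k *v \<zeta> \<and> (\<forall>l. \<bar>\<zeta> $ l\<bar> \<le> a $ l + t)"
    by blast
next
  assume "\<exists>\<zeta>. z = c + G k *v \<zeta> \<and> (\<forall>l. \<bar>\<zeta> $ l\<bar> \<le> a $ l + t)"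
  then obtain \<zeta> where \<zeta>: "z = c + G k *v \<zeta>" "\<And>l. \<bar>\<zeta> $ l\<bar> \<le> a $ l + t"
    by blast
  have "Max (range (\<lambda>l. \<bar>\<zeta> $ l\<bar> - a $ l)) \<le> t"
    using \<zeta>(2) by (auto simp: algebra_simps)
  with \<zeta>(1) show "zonotope_constraint G k z (c, a) \<le> ereal t"
    by (auto simp: zonotope_constraint_def intro!: INF_lower2[of \<zeta>])
qed

lemma vector_abs_le_iff:
  fixes \<zeta> a :: "real ^ 'm"
  shows "- (a + t *\<^sub>R 1) \<le> \<zeta> \<and> \<zeta> \<le> a + t *\<^sub>R 1 \<longleftrightarrow> (\<forall>l. \<bar>\<zeta> $ l\<bar> \<le> a $ l + t)"
proof -
  have "- b \<le> y \<and> y \<le> b \<longleftrightarrow> \<bar>y\<bar> \<le> b" for y b :: real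
    by linarith
  from this[of "a $ l + t" "\<zeta> $ l" for l] show ?thesis
    by (simp add: less_eq_vec_def flip: all_conj_distrib)
qed

text \<open>Feasibility in the split program says that each index admits a representation \<open>\<zeta>\<close>;
  choosing one for every index gives the family of auxiliary variables.\<close>

lemma equivalent_via_forget_representations:
  fixes G :: "nat \<Rightarrow> real ^ 'm ^ 'n"
  shows "equivalent_via (\<lambda>(c, a, \<xi>, \<zeta>). (c, a, \<xi>))
    (split_program T N \<rho> M x UNIV {a. \<forall>l. 0 \<le> a $ l} (\<lambda>k (c, a). 1 \<bullet> a) (zonotope_constraint G))
    (zonotope_program T N \<rho> M x G)"
    (is "equivalent_via ?\<pi> ?P ?Q")
proof -
  have constraint: "(\<forall>(j, k, i)\<in>index_set T N M.
         zonotope_constraint G k (x i j k) (c k, a k) \<le> ereal (\<xi> i)) \<longleftrightarrow>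
      (\<exists>\<zeta>. \<zeta> \<in> index_set T N M \<rightarrow>\<^sub>E UNIV \<and> (\<forall>(j, k, i)\<in>index_set T N M.
         c k + G k *v \<zeta> (j, k, i) = x i j k \<and>
         - (a k + \<xi> i *\<^sub>R 1) \<le> \<zeta> (j, k, i) \<and> \<zeta> (j, k, i) \<le> a k + \<xi> i *\<^sub>R 1))"
    (is "?L \<longleftrightarrow> ?R") for c a \<xi>
  proof
    assume ?L
    then have "\<forall>q\<in>index_set T N M. \<exists>\<zeta>. case q of (j, k, i) \<Rightarrow>
        x i j k = c k + G k *v \<zeta> \<and> (\<forall>l. \<bar>\<zeta> $ l\<bar> \<le> a k $ l + \<xi> i)"
      by (auto simp: zonotope_constraint_le_iff)
    from bchoice[OF this] obtain \<zeta> where "\<forall>q\<in>index_set T N M. case q of (j, k, i) \<Rightarrow>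
        x i j k = c k + G k *v \<zeta> q \<and> (\<forall>l. \<bar>\<zeta> q $ l\<bar> \<le> a k $ l + \<xi> i)"
      by blast
    then show ?R
      unfolding vector_abs_le_iff by (intro exI[of _ "restrict \<zeta> (index_set T N M)"]) auto
  next
    assume ?R
    then obtain \<zeta> where \<zeta>: "\<forall>(j, k, i)\<in>index_set T N M.
        c k + G k *v \<zeta> (j, k, i) = x i j k \<and> (\<forall>l. \<bar>\<zeta> (j, k, i) $ l\<bar> \<le> a k $ l + \<xi> i)"
      unfolding vector_abs_le_iff by blast
    have "zonotope_constraint G k (x i j k) (c k, a k) \<le> ereal (\<xi> i)"
      if "(j, k, i) \<in> index_set T N M" for j k i
      unfolding zonotope_constraint_le_iff
      using bspec[OF \<zeta> that] by (intro exI[of _ "\<zeta> (j, k, i)"]) simp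
    then show ?L
      by blast
  qed
  have "w \<in> ?\<pi> ` feasible ?Q \<longleftrightarrow> w \<in> feasible ?P" for w
  proof (cases w)
    case (fields c a \<xi>)
    have "(\<exists>\<zeta>. (c, a, \<xi>, \<zeta>) \<in> feasible ?Q) \<longleftrightarrow> (c, a, \<xi>) \<in> feasible ?P"
      unfolding split_program_def zonotope_program_def program.sel mem_Collect_eq prod.case constraint
      by blast
    moreover have "(c, a, \<xi>) \<in> ?\<pi> ` W \<longleftrightarrow> (\<exists>\<zeta>. (c, a, \<xi>, \<zeta>) \<in> W)" for W
      by force
    ultimately show ?thesis
      unfolding fields by blast
  qed
  then have "?\<pi> ` feasible ?Q = feasible ?P"
    by blast
  moreover have "objective ?P (?\<pi> w) = objective ?Q w" for w
    by (cases w) (auto simp: split_program_def zonotope_program_def)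
  ultimately show ?thesis
    by (simp add: equivalent_via_def)
qed

lemma equivalent_via_trans:
  assumes "equivalent_via \<pi> P Q" "equivalent_via \<sigma> Q R"
  shows "equivalent_via (\<pi> \<circ> \<sigma>) P R"
proof -
  have "(\<pi> \<circ> \<sigma>) ` feasible R = feasible P"
    using assms unfolding image_comp[symmetric] by (simp add: equivalent_via_def)
  moreover have "objective P (\<pi> (\<sigma> w)) = objective R w" if "w \<in> feasible R" for w
  proof -
    have "\<sigma> w \<in> feasible Q"
      using assms(2) that by (auto simp: equivalent_via_def)
    then show ?thesis
      using assms that by (simp add: equivalent_via_def)
  qed
  ultimately show ?thesis
    by (simp add: equivalent_via_def)
qed


section \<open>The three reformulations\<close>

theorem lemma2:
  fixes T N :: nat
    and \<rho> :: real
    and M :: "nat \<Rightarrow> 'j set"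
    and x :: "nat \<Rightarrow> 'j \<Rightarrow> nat \<Rightarrow> real ^ 'n"
    and p :: ereal
    and H :: "nat \<Rightarrow> real ^ 'n ^ 'n"
    and G :: "nat \<Rightarrow> real ^ 'm ^ 'n"
  assumes "\<rho> > 0"
    and "\<forall>i\<in>{1..N}. finite (M i)"
  shows
    "(1 \<le> p \<longrightarrow>
        (\<forall>k\<in>{0..T}. \<forall>c. \<forall>r\<ge>0.
           reach_set (ball_constraint p) k (c, r) = {z :: real ^ 'n. pnorm p (z - c) \<le> r}) \<and>
        equivalent_renaming (pair_params T)
          (adversarial_program T N \<rho> M x (center_radius_params T) (\<lambda>k (c, r). r)
             (ball_constraint p))
          (ball_program T N \<rho> M x p)) \<and>
     ((\<forall>k\<in>{0..T}. positive_definite_matrix (H k)) \<longrightarrow>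
        (\<forall>k\<in>{0..T}. \<forall>c. \<forall>s\<ge>0.
           reach_set (ellipsoid_constraint H) k (c, s) = {z. norm (H k *v (z - c)) \<le> s}) \<and>
        equivalent_renaming (pair_params T)
          (adversarial_program T N \<rho> M x (center_radius_params T) (\<lambda>k (c, s). s)
             (ellipsoid_constraint H))
          (ellipsoid_program T N \<rho> M x H)) \<and>
     ((\<forall>k\<in>{0..T}. \<forall>c a. (\<forall>l. 0 \<le> a $ l) \<longrightarrow>
         reach_set (zonotope_constraint G) k (c, a) =
           {z. \<exists>\<zeta>. z = c + G k *v \<zeta> \<and> (\<forall>l. \<bar>\<zeta> $ l\<bar> \<le> a $ l)}) \<and>
      equivalent_via (pair_params_forget T)
        (adversarial_program T N \<rho> M x (zonotope_params T) (\<lambda>k (c, a). 1 \<bullet> a)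
           (zonotope_constraint G))
        (zonotope_program T N \<rho> M x G))"
proof (intro conjI impI ballI allI)
  \<comment> \<open>The candidate sets are the case \<open>t = 0\<close> of the descriptions of \<open>g_k(z, \<theta>_k) \<le> t\<close>.\<close>
  fix k c and r :: real
  show "reach_set (ball_constraint p) k (c, r) = {z :: real ^ 'n. pnorm p (z - c) \<le> r}"
    using ball_constraint_le_iff[of p k _ c r 0] by (simp add: reach_set_def flip: zero_ereal_def)
next
  show "equivalent_renaming (pair_params T)
      (adversarial_program T N \<rho> M x (center_radius_params T) (\<lambda>k (c, r). r) (ball_constraint p))
      (ball_program T N \<rho> M x p)"
    unfolding ball_program_eq_split_program center_radius_params_def
    by (rule equivalent_renaming_split_program)
next
  fix k c and s :: real
  show "reach_set (ellipsoid_constraint H) k (c, s) = {z. norm (H k *v (z - c)) \<le> s}"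
    using ellipsoid_constraint_le_iff[of H k _ c s 0] by (simp add: reach_set_def flip: zero_ereal_def)
next
  show "equivalent_renaming (pair_params T)
      (adversarial_program T N \<rho> M x (center_radius_params T) (\<lambda>k (c, s). s)
        (ellipsoid_constraint H))
      (ellipsoid_program T N \<rho> M x H)"
    unfolding ellipsoid_program_eq_split_program center_radius_params_def
    by (rule equivalent_renaming_split_program)
next
  fix k c and a :: "real ^ 'm"
  show "reach_set (zonotope_constraint G) k (c, a) =
      {z. \<exists>\<zeta>. z = c + G k *v \<zeta> \<and> (\<forall>l. \<bar>\<zeta> $ l\<bar> \<le> a $ l)}"
    using zonotope_constraint_le_iff[of G k _ c a 0] by (simp add: reach_set_def flip: zero_ereal_def)
next
  have forget: "pair_params_forget T = pair_params T \<circ> (\<lambda>(c, a, \<xi>, \<zeta>). (c, a, \<xi>))"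
    by (auto simp: pair_params_forget_def)
  show "equivalent_via (pair_params_forget T)
      (adversarial_program T N \<rho> M x (zonotope_params T) (\<lambda>k (c, a). 1 \<bullet> a)
        (zonotope_constraint G))
      (zonotope_program T N \<rho> M x G)"
    unfolding forget zonotope_params_def
  proof (rule equivalent_via_trans[OF _ equivalent_via_forget_representations])
    show "equivalent_via (pair_params T)
        (adversarial_program T N \<rho> M x ({0..T} \<rightarrow>\<^sub>E UNIV \<times> {a. \<forall>l. 0 \<le> a $ l})
          (\<lambda>k (c, a). 1 \<bullet> a) (zonotope_constraint G))
        (split_program T N \<rho> M x UNIV {a. \<forall>l. 0 \<le> a $ l} (\<lambda>k (c, a). 1 \<bullet> a)
          (zonotope_constraint G))"
      using equivalent_renaming_split_program unfolding equivalent_renaming_def by (rule conjunct1)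
  qed
qed

end
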